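(* Let $p$ be a prime number, let $\alpha \in \mathbb{N}$, let $F$ be a finite field with $q = p^{\alpha}$ elements, let $n \in \mathbb{N}$, let $$f = \sum_{\mathbf{e} \in E} c_{\mathbf{e}}\, x_1^{e_1} \cdots x_n^{e_n} \in F[x_1,\ldots,x_n],$$ where $E$ is a finite subset of $\mathbb{N}_0^n$ and $(c_{\mathbf{e}})_{\mathbf{e}\in E}$ is a family from $F \setminus\{0\}$, and let $\overline{f}$ be the function from $F^n$ to $F$ induced by $f$. Then $\operatorname{Fdeg}(\overline{f}) \le \deg_p(f)$. If all exponents occurring in $f$ are at most $q-1$, i.e., if $E \subseteq \{0,1,\ldots,q-1\}^n$, then $\operatorname{Fdeg}(\overline{f}) = \deg_p(f)$.
   Context: $\mathbb{N}$ is the set of positive integers, $\mathbb{N}_0 = \mathbb{N} \cup \{0\}$. For $n \in \mathbb{N}_0$, $s_p(n)$ denotes the digit sum of $n$ in base $p$. For a field $F$ of characteristic $p$, the $p$-weight degree of a monomial $c \prod_{i=1}^n x_i^{e_i}$ with $c \in F\setminus\{0\}$ is $\sum_{i=1}^n s_p(e_i)$; the $p$-weight degree $\deg_p(f)$ of a nonzero polynomial is the maximum of the $p$-weight degrees of its monomials, and $\deg_p(0) := 0$. For an (additively written) abelian group $A$, $\mathbb{Z}[A]$ is the integral group ring; its elements are written as finite sums $\sum_{a\in A} z_a \tau_a$ with $z_a \in \mathbb{Z}$, and $\tau_a \cdot \tau_b = \tau_{a+b}$. The augmentation ideal $\operatorname{Aug}(\mathbb{Z}[A])$ is the ideal of $\mathbb{Z}[A]$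 generated by $\{\tau_a - 1 \mid a \in A\}$. For an ideal $I$, $I^0 = \mathbb{Z}[A]$ and $I^n$ is the ideal generated by all products $i_1\cdots i_n$ with $i_1,\ldots,i_n \in I$. For an abelian group $B$, the ring $\mathbb{Z}[A]$ acts on the group $B^A$ of all functions $f : A \to B$ by $((\sum_{a} z_a \tau_a) * f)(x) = \sum_{a} z_a f(x+a)$. For an ideal $J$, $J * f = 0$ means $j * f = 0$ for all $j \in J$. Functional degree: for a function $f : A \to B$ between abelian groups and $I := \operatorname{Aug}(\mathbb{Z}[A])$, $\operatorname{Fdeg}(f) := \min\{ n \in \mathbb{N}_0 \mid I^{n+1} * f = 0\}$, with $\operatorname{Fdeg}(f) = \infty$ if no such $n$ exists. Here $\operatorname{Fdeg}(\overline{f})$ refers to the additive groups of $F^n$ and $F$. *)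

theory Defs
  imports
    "HOL-Analysis.Finite_Cartesian_Product"
    "HOL-Computational_Algebra.Primes"
    "HOL-Library.Poly_Mapping"
    "HOL-Library.Extended_Nat"
begin

section \<open>Ideals of a commutative ring\<close>

text \<open>A commutative ring is a module over itself; its submodules are its ideals, and the
  submodule spanned by a set is the ideal generated by that set.\<close>

global_interpretation self_module: module "(*) :: 'a::comm_ring_1 \<Rightarrow> 'a \<Rightarrow> 'a"
  defines ideal_gen = self_module.span
  by standard (simp_all add: algebra_simps)

definition ideal_power :: "'a::comm_ring_1 set \<Rightarrow> nat \<Rightarrow> 'a set" where
  "ideal_power I n = ideal_gen {\<Prod>k<n. i k | i. \<forall>k<n. i k \<in> I}"

lemma ideal_power_0: "ideal_power I 0 = UNIV"
proof -
  have "x \<in> ideal_gen {1}" for x :: 'a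
    using self_module.span_scale[OF self_module.span_base[of 1 "{1}"], of x] by simp
  then show ?thesis by (auto simp: ideal_power_def)
qed


section \<open>The integral group ring and its action on functions\<close>

text \<open>The integral group ring of \<open>'g\<close> is the type \<open>'g \<Rightarrow>\<^sub>0 int\<close> of finitely supported functions,
  whose library multiplication is convolution.\<close>

definition tau :: "'g \<Rightarrow> 'g \<Rightarrow>\<^sub>0 int" where
  "tau a = Poly_Mapping.single a 1"

lemma tau_mult: "tau a * tau b = tau (a + b :: 'g::ab_group_add)"
  by (simp add: tau_def Poly_Mapping.mult_single)

definition Aug :: "('g::ab_group_add \<Rightarrow>\<^sub>0 int) set" where
  "Aug = ideal_gen {tau a - 1 | a. True}"

text \<open>The integer multiple \<open>k b\<close> in an abelian group; one of the two sums is always empty.\<close>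

definition int_scale :: "int \<Rightarrow> 'b::ab_group_add \<Rightarrow> 'b" where
  "int_scale k b = (\<Sum>i<nat k. b) - (\<Sum>i<nat (- k). b)"

definition group_ring_act ::
    "('g::ab_group_add \<Rightarrow>\<^sub>0 int) \<Rightarrow> ('g \<Rightarrow> 'b::ab_group_add) \<Rightarrow> 'g \<Rightarrow> 'b" where
  "group_ring_act z f = (\<lambda>x. \<Sum>a\<in>Poly_Mapping.keys z. int_scale (Poly_Mapping.lookup z a) (f (x + a)))"

definition annihilates ::
    "('g::ab_group_add \<Rightarrow>\<^sub>0 int) set \<Rightarrow> ('g \<Rightarrow> 'b::ab_group_add) \<Rightarrow> bool" where
  "annihilates J f \<longleftrightarrow> (\<forall>j\<in>J. group_ring_act j f = (\<lambda>x. 0))"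

definition Fdeg :: "('g::ab_group_add \<Rightarrow> 'b::ab_group_add) \<Rightarrow> enat" where
  "Fdeg f = (if \<exists>n. annihilates (ideal_power Aug (n + 1)) f
             then enat (LEAST n. annihilates (ideal_power Aug (n + 1)) f)
             else \<infinity>)"


section \<open>Multivariate polynomials and the weight degree\<close>

text \<open>Polynomials over \<open>'a\<close> in variables indexed by the finite type \<open>'n\<close> are elements of
  \<open>('n \<Rightarrow>\<^sub>0 nat) \<Rightarrow>\<^sub>0 'a\<close>: an element of \<open>'n \<Rightarrow>\<^sub>0 nat\<close> is an exponent vector.\<close>

definition poly_fun ::
    "(('n::finite \<Rightarrow>\<^sub>0 nat) \<Rightarrow>\<^sub>0 'a::comm_ring_1) \<Rightarrow> 'a ^ 'n \<Rightarrow> 'a" where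
  "poly_fun f x =
     (\<Sum>e\<in>Poly_Mapping.keys f. Poly_Mapping.lookup f e * (\<Prod>i\<in>UNIV. (x $ i) ^ Poly_Mapping.lookup e i))"

text \<open>The base \<open>p\<close> digit of \<open>n\<close> at position \<open>i\<close> is \<open>n div p ^ i mod p\<close>. For \<open>p \<ge> 2\<close> the positions
  \<open>i < n\<close> cover all nonzero digits, because \<open>n < p ^ n\<close>.\<close>

definition digit_sum :: "nat \<Rightarrow> nat \<Rightarrow> nat" where
  "digit_sum p n = (\<Sum>i<n. n div p ^ i mod p)"

definition weight :: "nat \<Rightarrow> ('n::finite \<Rightarrow>\<^sub>0 nat) \<Rightarrow> nat" where
  "weight p e = (\<Sum>i\<in>UNIV. digit_sum p (Poly_Mapping.lookup e i))"

definition weight_degree :: "nat \<Rightarrow> (('n::finite \<Rightarrow>\<^sub>0 nat) \<Rightarrow>\<^sub>0 'a::zero) \<Rightarrow> nat" where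
  "weight_degree p f = (if f = 0 then 0 else Max (weight p ` Poly_Mapping.keys f))"

end

theory Submission
  imports Defs "HOL-Number_Theory.Residues" "HOL-Computational_Algebra.Polynomial"
begin

text \<open>
  A function is killed by the \<open>n\<close>-th power of the augmentation ideal iff all its \<open>n\<close>-fold iterated
  differences vanish. The upper bound follows from the product rule for differences, since
  \<open>x ^ e\<close> is the product of \<open>s\<^sub>p(e)\<close> powers \<open>x ^ p ^ j\<close>, each of which is additive.
  For the lower bound, functions whose \<open>n\<close>-fold differences vanish form a space that is stable under
  the substitutions \<open>x\<^sub>i \<mapsto> \<lambda>\<^sub>i x\<^sub>i\<close>. If all exponents are below \<open>q\<close>, linear combinations
  of these substitutions isolate each monomial occurring in a function. So it suffices to look at a
  single monomial; writing an exponent as \<open>p ^ j m\<close> with \<open>m\<close> prime to \<open>p\<close>, the difference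
  \<open>(x ^ p ^ j + 1) ^ m - (x ^ p ^ j) ^ m\<close> contains \<open>x ^ (p ^ j (m - 1))\<close> with coefficient
  \<open>m \<noteq> 0\<close>, so one difference lowers the weight by exactly one.
\<close>

section \<open>The action of the group ring\<close>

lemma int_scale_zero_left [simp]: "int_scale 0 b = 0"
  by (simp add: int_scale_def)

lemma int_scale_one [simp]: "int_scale 1 b = b"
  by (simp add: int_scale_def)

text \<open>As \<open>int_scale\<close> is a difference of two truncated sums, the sign of
  \<open>k\<close> has to be distinguished here. Additivity and multiplicativity in the integer
  argument are then derived from this law.\<close>

lemma int_scale_add_one: "int_scale (k + 1) b = int_scale k b + b"
proof (cases "k \<ge> 0")
  case True
  then show ?thesis by (simp add: int_scale_def nat_add_distrib)
next
  case False
  then have "nat (- k) = Suc (nat (- (k + 1)))" by simp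
  then show ?thesis using False by (simp add: int_scale_def)
qed

lemma int_scale_minus_one: "int_scale (k - 1) b = int_scale k b - b"
  using int_scale_add_one[of "k - 1" b] by simp

lemma int_scale_add_left: "int_scale (k + l) b = int_scale k b + int_scale l b"
proof (induction l rule: int_induct[of _ 0])
  case (step1 i)
  then show ?case using int_scale_add_one[of "k + i" b] int_scale_add_one[of i b] by (simp add: add_ac)
next
  case (step2 i)
  then show ?case using int_scale_minus_one[of "k + i" b] int_scale_minus_one[of i b]
    by (simp add: add_diff_eq)
qed simp

lemma int_scale_add_right: "int_scale k (b + c) = int_scale k b + int_scale k c"
  by (simp add: int_scale_def sum.distrib)

lemma int_scale_zero_right [simp]: "int_scale k 0 = 0"
  by (simp add: int_scale_def)

lemma int_scale_minus_left: "int_scale (- k) b = - int_scale k b"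
  using int_scale_add_left[of k "- k" b] by (simp add: add_eq_0_iff)

lemma int_scale_diff_left: "int_scale (k - l) b = int_scale k b - int_scale l b"
  using int_scale_add_left[of k "- l" b] by (simp add: int_scale_minus_left)

lemma int_scale_mult: "int_scale (k * l) b = int_scale k (int_scale l b)"
  by (induction k rule: int_induct[of _ 0])
     (simp_all add: ring_distribs int_scale_add_left int_scale_add_one int_scale_minus_one
        int_scale_diff_left)

lemma poly_mapping_eq_sum_single:
  "z = (\<Sum>a\<in>Poly_Mapping.keys z. Poly_Mapping.single a (Poly_Mapping.lookup z a))"
  by (rule poly_mapping_eqI)
     (auto simp: lookup_sum lookup_single when_def in_keys_iff)

text \<open>Group ring elements are finite sums of terms \<open>Poly_Mapping.single a k\<close>, so
  laws of the action can be checked one term at a time.\<close>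

lemma poly_mapping_add_induct [case_names zero add]:
  fixes z :: "'a \<Rightarrow>\<^sub>0 'b::comm_monoid_add"
  assumes "P 0" and "\<And>a k w. P w \<Longrightarrow> P (Poly_Mapping.single a k + w)"
  shows "P z"
proof -
  have "P (\<Sum>a\<in>A. Poly_Mapping.single a (h a))" for A h
    by (induction A rule: infinite_finite_induct) (simp_all add: assms)
  then show ?thesis
    by (subst poly_mapping_eq_sum_single)
qed

lemma group_ring_act_zero [simp]: "group_ring_act 0 f = (\<lambda>x. 0)"
  by (simp add: group_ring_act_def)

text \<open>Coefficients may cancel, so the support of \<open>z + w\<close> can be smaller than the
  union of the supports; this does no harm because \<open>int_scale\<close> vanishes at coefficient
  0.\<close>

lemma group_ring_act_add:
  "group_ring_act (z + w) f = (\<lambda>x. group_ring_act z f x + group_ring_act w f x)"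
  unfolding group_ring_act_def
  by (rule ext, rule setsum_keys_plus_distrib) (simp_all add: int_scale_add_left)

lemma group_ring_act_uminus: "group_ring_act (- z) f = (\<lambda>x. - group_ring_act z f x)"
  by (simp add: group_ring_act_def int_scale_minus_left sum_negf)

lemma group_ring_act_single:
  "group_ring_act (Poly_Mapping.single a k) f = (\<lambda>x. int_scale k (f (x + a)))"
  by (simp add: group_ring_act_def)

lemma group_ring_act_one [simp]: "group_ring_act 1 f = f"
  using group_ring_act_single[of 0 1 f] by simp

lemma group_ring_act_zero_right [simp]: "group_ring_act z (\<lambda>x. 0) = (\<lambda>x. 0)"
  by (simp add: group_ring_act_def)

lemma group_ring_act_add_right:
  "group_ring_act z (\<lambda>x. f x + g x) = (\<lambda>x. group_ring_act z f x + group_ring_act z g x)"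
  by (simp add: group_ring_act_def int_scale_add_right sum.distrib)

lemma group_ring_act_single_mult:
  "group_ring_act (Poly_Mapping.single a k * w) f =
   group_ring_act (Poly_Mapping.single a k) (group_ring_act w f)"
  by (induction w rule: poly_mapping_add_induct)
     (simp_all add: distrib_left group_ring_act_add group_ring_act_add_right mult_single
       group_ring_act_single int_scale_mult add.assoc int_scale_add_right)

text \<open>With this law the functions form a module over the group ring, so a product of
  generators \<open>tau a - 1\<close> acts as an iterated difference.\<close>

lemma group_ring_act_mult:
  "group_ring_act (z * w) f = group_ring_act z (group_ring_act w f)"
  by (induction z rule: poly_mapping_add_induct)
     (simp_all add: distrib_right group_ring_act_add group_ring_act_single_mult)

definition difference :: "'g::ab_group_add \<Rightarrow> ('g \<Rightarrow> 'b::ab_group_add) \<Rightarrow> 'g \<Rightarrow> 'b" where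
  "difference a f = (\<lambda>x. f (x + a) - f x)"

lemma group_ring_act_tau_minus_one: "group_ring_act (tau a - 1) f = difference a f"
proof -
  have "group_ring_act (tau a + - 1) f = difference a f"
    unfolding group_ring_act_add group_ring_act_uminus
    by (simp add: tau_def group_ring_act_single difference_def)
  then show ?thesis by simp
qed

section \<open>Iterated differences\<close>

text \<open>The index counts differences and thus exceeds the degree by one: index
  \<open>Suc d\<close> means degree at most \<open>d\<close>, and index 0 is left for the zero
  function.\<close>

primrec differences_vanish :: "nat \<Rightarrow> ('g::ab_group_add \<Rightarrow> 'b::ab_group_add) \<Rightarrow> bool" where
  "differences_vanish 0 f \<longleftrightarrow> f = (\<lambda>x. 0)"
| "differences_vanish (Suc n) f \<longleftrightarrow> (\<forall>a. differences_vanish n (difference a f))"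

lemma differences_vanish_zero [simp]: "differences_vanish n (\<lambda>x. 0)"
  by (induction n) (simp_all add: difference_def)

lemma differences_vanish_Suc: "differences_vanish n f \<Longrightarrow> differences_vanish (Suc n) f"
proof (induction n arbitrary: f)
  case 0
  then show ?case by (simp add: difference_def)
next
  case (Suc n)
  then show ?case by (meson differences_vanish.simps(2))
qed

lemma differences_vanish_mono:
  "m \<le> n \<Longrightarrow> differences_vanish m f \<Longrightarrow> differences_vanish n f"
  by (induction n rule: dec_induct) (blast intro: differences_vanish_Suc)+

lemma differences_vanish_add:
  "differences_vanish n f \<Longrightarrow> differences_vanish n g \<Longrightarrow> differences_vanish n (\<lambda>x. f x + g x)"
proof (induction n arbitrary: f g)
  case (Suc n)
  have "difference a (\<lambda>x. f x + g x) = (\<lambda>x. difference a f x + difference a g x)" for a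
    by (simp add: difference_def algebra_simps)
  then show ?case using Suc by simp
qed simp

lemma differences_vanish_sum:
  "(\<And>i. i \<in> A \<Longrightarrow> differences_vanish n (f i)) \<Longrightarrow> differences_vanish n (\<lambda>x. \<Sum>i\<in>A. f i x)"
  by (induction A rule: infinite_finite_induct) (simp_all add: differences_vanish_add)

lemma differences_vanish_compose_additive:
  assumes "additive h" and "differences_vanish n f"
  shows "differences_vanish n (\<lambda>x. h (f x))"
  using assms(2)
proof (induction n arbitrary: f)
  case 0
  then show ?case by (simp add: additive.zero[OF assms(1)])
next
  case (Suc n)
  have "difference a (\<lambda>x. h (f x)) = (\<lambda>x. h (difference a f x))" for a
    by (simp add: difference_def additive.diff[OF assms(1)])
  then show ?case using Suc by simp
qed

text \<open>Precomposition with a homomorphism \<open>h\<close> turns the difference along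
  \<open>a\<close> into the one along \<open>h a\<close>. The instance needed later is the scaling
  of coordinates.\<close>

lemma differences_vanish_precompose_additive:
  assumes "additive h" and "differences_vanish n f"
  shows "differences_vanish n (\<lambda>x. f (h x))"
  using assms(2)
proof (induction n arbitrary: f)
  case (Suc n)
  have "difference a (\<lambda>x. f (h x)) = (\<lambda>x. difference (h a) f (h x))" for a
    by (simp add: difference_def additive.add[OF assms(1)])
  then show ?case using Suc by simp
qed simp

lemma differences_vanish_scale:
  fixes f :: "'g::ab_group_add \<Rightarrow> 'a::ring"
  shows "differences_vanish n f \<Longrightarrow> differences_vanish n (\<lambda>x. c * f x)"
  by (rule differences_vanish_compose_additive) (simp_all add: additive_def distrib_left)

lemma differences_vanish_shift:
  "differences_vanish n f \<Longrightarrow> differences_vanish n (\<lambda>x. f (x + a))"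
proof (induction n arbitrary: f)
  case (Suc n)
  have "difference b (\<lambda>x. f (x + a)) = (\<lambda>x. difference b f (x + a))" for b
    by (simp add: difference_def add_ac)
  then show ?case using Suc by simp
qed (simp add: fun_eq_iff)

section \<open>Powers of the augmentation ideal and iterated differences\<close>

lemma differences_vanish_group_ring_act:
  "differences_vanish n f \<Longrightarrow> differences_vanish n (group_ring_act z f)"
  unfolding group_ring_act_def
  by (intro differences_vanish_sum differences_vanish_compose_additive[of "int_scale _"]
       differences_vanish_shift) (simp_all add: additive_def int_scale_add_right)

text \<open>Each generator \<open>tau a - 1\<close> uses up one difference, while its group ring
  coefficient \<open>c\<close> costs nothing.\<close>

lemma differences_vanish_Aug:
  assumes f: "differences_vanish (Suc n) f" and z: "z \<in> Aug"
  shows "differences_vanish n (group_ring_act z f)"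
  using z unfolding Aug_def
proof (induction rule: self_module.span_induct_alt)
  case base
  then show ?case by simp
next
  case (step c x y)
  then obtain a where "x = tau a - 1" by blast
  then have "differences_vanish n (group_ring_act (c * x) f)"
    using f by (simp add: group_ring_act_mult group_ring_act_tau_minus_one
        differences_vanish_group_ring_act)
  then show ?case using step by (simp add: group_ring_act_add differences_vanish_add)
qed

lemma differences_vanish_act_prod_Aug:
  assumes "differences_vanish n f" and "\<forall>k<n. i k \<in> Aug"
  shows "group_ring_act (\<Prod>k<n. i k) f = (\<lambda>x. 0)"
  using assms
proof (induction n arbitrary: f)
  case (Suc n)
  have "differences_vanish n (group_ring_act (i n) f)"
    by (rule differences_vanish_Aug) (use Suc.prems in auto)
  then show ?case using Suc by (simp add: group_ring_act_mult)
qed simp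

lemma differences_vanish_if_act_prod:
  assumes "\<And>a. group_ring_act (\<Prod>k<n. tau (a k) - 1) f = (\<lambda>x. 0)"
  shows "differences_vanish n f"
  using assms
proof (induction n arbitrary: f)
  case (Suc n)
  have "differences_vanish n (difference b f)" for b
  proof (rule Suc.IH)
    fix a
    \<comment> \<open>The last factor acts first, so overwriting the direction at position
      \<open>n\<close> by \<open>b\<close> makes the product act on
      \<open>difference b f\<close>.\<close>
    have "(\<Prod>k<Suc n. tau ((a(n := b)) k) - 1) = (\<Prod>k<n. tau (a k) - 1) * (tau b - 1)"
      by simp
    then show "group_ring_act (\<Prod>k<n. tau (a k) - 1) (difference b f) = (\<lambda>x. 0)"
      using Suc.prems[of "a(n := b)"]
      by (simp only: group_ring_act_mult group_ring_act_tau_minus_one)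
  qed
  then show ?case by simp
qed simp

text \<open>Products of elements \<open>tau a - 1\<close> lie in the ideal power and act as iterated
  differences. Conversely, the elements killing \<open>f\<close> form an ideal, so it suffices to
  kill the products generating the power.\<close>

lemma annihilates_ideal_power_iff:
  "annihilates (ideal_power Aug n) f \<longleftrightarrow> differences_vanish n f"
proof
  assume ann: "annihilates (ideal_power Aug n) f"
  show "differences_vanish n f"
  proof (rule differences_vanish_if_act_prod)
    fix a :: "nat \<Rightarrow> 'a"
    have "tau b - 1 \<in> Aug" for b :: 'a
      unfolding Aug_def by (rule self_module.span_base) blast
    then have "(\<Prod>k<n. tau (a k) - 1) \<in> ideal_power Aug n"
      unfolding ideal_power_def by (intro self_module.span_base) blast
    then show "group_ring_act (\<Prod>k<n. tau (a k) - 1) f = (\<lambda>x. 0)"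
      using ann by (simp add: annihilates_def)
  qed
next
  assume f: "differences_vanish n f"
  have "group_ring_act z f = (\<lambda>x. 0)" if "z \<in> ideal_power Aug n" for z
    using that unfolding ideal_power_def
  proof (induction rule: self_module.span_induct_alt)
    case (step c x y)
    then have "group_ring_act x f = (\<lambda>x. 0)"
      using differences_vanish_act_prod_Aug[OF f] by blast
    then show ?case using step by (simp add: group_ring_act_add group_ring_act_mult)
  qed simp
  then show "annihilates (ideal_power Aug n) f"
    by (simp add: annihilates_def)
qed

text \<open>Vanishing persists when the index grows, so the least index may be replaced by any
  larger one; the finite bound excludes infinite degree.\<close>

lemma Fdeg_le_iff: "Fdeg f \<le> enat d \<longleftrightarrow> differences_vanish (Suc d) f"
proof
  assume "Fdeg f \<le> enat d"
  then obtain m where "differences_vanish (Suc m) f"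
      and "(LEAST n. differences_vanish (Suc n) f) \<le> d"
    by (auto simp: Fdeg_def annihilates_ideal_power_iff simp del: differences_vanish.simps
        split: if_splits)
  then show "differences_vanish (Suc d) f"
    by (metis (mono_tags, lifting) LeastI Suc_le_mono differences_vanish_mono)
next
  assume d: "differences_vanish (Suc d) f"
  then have "(LEAST n. differences_vanish (Suc n) f) \<le> d"
    by (rule Least_le)
  then show "Fdeg f \<le> enat d"
    using d by (auto simp: Fdeg_def annihilates_ideal_power_iff simp del: differences_vanish.simps)
qed

section \<open>Differences of products and powers\<close>

lemma differences_vanish_mult:
  fixes f g :: "'g::ab_group_add \<Rightarrow> 'a::comm_ring_1"
  assumes "differences_vanish (Suc m) f" and "differences_vanish (Suc n) g"
  shows "differences_vanish (Suc (m + n)) (\<lambda>x. f x * g x)"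
proof -
  \<comment> \<open>Without the successors the induction can descend to index 0. There one factor is
    zero, so truncation in \<open>m + n - 1\<close> is harmless.\<close>
  have "differences_vanish (m + n - 1) (\<lambda>x. f x * g x)"
    if "differences_vanish m f" "differences_vanish n g"
    for m n and f g :: "'g \<Rightarrow> 'a"
    using that
  proof (induction "m + n" arbitrary: m n f g rule: less_induct)
    case less
    show ?case
    proof (cases "m = 0 \<or> n = 0")
      case True
      then show ?thesis using less.prems by auto
    next
      case False
      then obtain k l where [simp]: "m = Suc k" "n = Suc l"
        by (meson not0_implies_Suc)
      have "differences_vanish (k + l) (difference a (\<lambda>x. f x * g x))" for a
      proof -
        have da: "differences_vanish k (difference a f)" "differences_vanish l (difference a g)"
          using less.prems by auto
        \<comment> \<open>Product rule with one factor shifted: each summand lowers the index of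
          exactly one factor.\<close>
        have "differences_vanish (k + l) (\<lambda>x. difference a f x * g x)"
          using less.hyps[of k n, OF _ da(1) less.prems(2)] by simp
        moreover have "differences_vanish (k + l) (\<lambda>x. f (x + a) * difference a g x)"
          using less.hyps[of m l, OF _ differences_vanish_shift[OF less.prems(1)] da(2)] by simp
        ultimately have "differences_vanish (k + l)
            (\<lambda>x. difference a f x * g x + f (x + a) * difference a g x)"
          by (rule differences_vanish_add)
        then show ?thesis
          by (simp add: difference_def algebra_simps)
      qed
      then show ?thesis by simp
    qed
  qed
  from this[OF assms] show ?thesis by simp
qed

lemma differences_vanish_const: "differences_vanish (Suc 0) (\<lambda>x. c)"
  by (simp add: difference_def)

lemma differences_vanish_additive: "additive h \<Longrightarrow> differences_vanish (Suc (Suc 0)) h"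
  by (simp add: difference_def additive_def)

lemma differences_vanish_power:
  fixes f :: "'g::ab_group_add \<Rightarrow> 'a::comm_ring_1"
  assumes "differences_vanish (Suc m) f"
  shows "differences_vanish (Suc (m * k)) (\<lambda>x. f x ^ k)"
proof (induction k)
  case 0
  show ?case using differences_vanish_const[of 1] by simp
next
  case (Suc k)
  then show ?case using differences_vanish_mult[OF assms Suc.IH] by simp
qed

lemma differences_vanish_prod:
  fixes f :: "'i \<Rightarrow> 'g::ab_group_add \<Rightarrow> 'a::comm_ring_1"
  assumes "finite A" and "\<And>i. i \<in> A \<Longrightarrow> differences_vanish (Suc (m i)) (f i)"
  shows "differences_vanish (Suc (\<Sum>i\<in>A. m i)) (\<lambda>x. \<Prod>i\<in>A. f i x)"
  using assms
proof (induction A rule: finite_induct)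
  case empty
  show ?case using differences_vanish_const[of 1] by simp
next
  case (insert i A)
  then show ?case
    using differences_vanish_mult[of "m i" "f i" "\<Sum>i\<in>A. m i" "\<lambda>x. \<Prod>i\<in>A. f i x"]
    by (simp del: differences_vanish.simps)
qed

section \<open>Digit sums\<close>

text \<open>The range of summation in \<open>digit_sum\<close> depends on the number itself; padding
  with zero digits allows sums of different lengths to be compared.\<close>

lemma digit_sum_eq_sum:
  assumes "p \<ge> 2" and "n \<le> N"
  shows "digit_sum p n = (\<Sum>i<N. n div p ^ i mod p)"
  unfolding digit_sum_def
proof (rule sum.mono_neutral_left)
  show "\<forall>i\<in>{..<N} - {..<n}. n div p ^ i mod p = 0"
  proof
    fix i assume i: "i \<in> {..<N} - {..<n}"
    have "i < p ^ i" using assms(1) by (simp add: power_gt_expt)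
    then show "n div p ^ i mod p = 0" using i by simp
  qed
qed (use assms in auto)

lemma digit_sum_0 [simp]: "digit_sum p 0 = 0"
  by (simp add: digit_sum_def)

lemma digit_sum_rec:
  assumes "p \<ge> 2"
  shows "digit_sum p n = n mod p + digit_sum p (n div p)"
proof -
  \<comment> \<open>One extra position is included, so that \<open>n\<close> positions remain after
    splitting off the lowest digit; they suffice for \<open>n div p\<close>.\<close>
  have "digit_sum p n = (\<Sum>i<Suc n. n div p ^ i mod p)"
    using assms by (intro digit_sum_eq_sum) auto
  also have "\<dots> = n mod p + (\<Sum>i<n. n div p div p ^ i mod p)"
    by (subst sum.lessThan_Suc_shift) (simp add: div_mult2_eq)
  also have "(\<Sum>i<n. n div p div p ^ i mod p) = digit_sum p (n div p)"
    using assms by (intro digit_sum_eq_sum[symmetric]) auto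
  finally show ?thesis .
qed

lemma digit_sum_power_mult:
  assumes "p \<ge> 2"
  shows "digit_sum p (p ^ j * m) = digit_sum p m"
proof (induction j)
  case (Suc j)
  have "digit_sum p (p * (p ^ j * m)) = digit_sum p (p ^ j * m)"
    using assms by (subst digit_sum_rec) auto
  then show ?case using Suc by (simp add: mult.assoc)
qed simp

text \<open>The lowest digit of \<open>m\<close> is nonzero, so subtracting 1 needs no
  borrow.\<close>

lemma digit_sum_pred:
  assumes "p \<ge> 2" and "\<not> p dvd m"
  shows "digit_sum p m = Suc (digit_sum p (m - 1))"
proof -
  have r: "m mod p \<noteq> 0" using assms(2) by (simp add: dvd_eq_mod_eq_0)
  have m: "m - 1 = p * (m div p) + (m mod p - 1)"
    using r mult_div_mod_eq[of p m] by linarith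
  have lt: "m mod p - 1 < p" using assms(1) mod_less_divisor[of p m] by linarith
  have "(m - 1) div p = m div p" "(m - 1) mod p = m mod p - 1"
    unfolding m using lt assms(1) by simp_all
  then show ?thesis
    using r digit_sum_rec[OF assms(1), of m] digit_sum_rec[OF assms(1), of "m - 1"] by simp
qed

section \<open>Monomials\<close>

lemma additive_power_CHAR:
  fixes h :: "'g::ab_group_add \<Rightarrow> 'a::comm_ring_1"
  assumes "prime CHAR('a)" and "additive h"
  shows "additive (\<lambda>x. h x ^ CHAR('a))"
  using assms by (simp add: additive_def freshmans_dream)

text \<open>Peel off the lowest digit: \<open>h ^ e\<close> is \<open>h ^ (e mod p)\<close> times
  the power \<open>e div p\<close> of \<open>h ^ p\<close>, where \<open>p\<close> is the
  characteristic. As \<open>h ^ p\<close> is again additive, the induction must range over all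
  \<open>h\<close>.\<close>

lemma differences_vanish_additive_power:
  fixes h :: "'g::ab_group_add \<Rightarrow> 'a::comm_ring_1"
  assumes "prime CHAR('a)" and "additive h"
  shows "differences_vanish (Suc (digit_sum CHAR('a) e)) (\<lambda>x. h x ^ e)"
  using assms(2)
proof (induction e arbitrary: h rule: less_induct)
  case (less e)
  let ?p = "CHAR('a)"
  have p: "?p \<ge> 2" using assms(1) by (rule prime_ge_2_nat)
  show ?case
  proof (cases "e = 0")
    case True
    then show ?thesis using differences_vanish_const[of 1] by simp
  next
    case False
    have low: "differences_vanish (Suc (e mod ?p)) (\<lambda>x. h x ^ (e mod ?p))"
      using differences_vanish_power[of 1 h] differences_vanish_additive[OF less.prems]
      by (simp del: differences_vanish.simps)
    have high: "differences_vanish (Suc (digit_sum ?p (e div ?p))) (\<lambda>x. (h x ^ ?p) ^ (e div ?p))"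
      using False p by (intro less.IH additive_power_CHAR assms(1) less.prems) auto
    have "h x ^ (e mod ?p) * (h x ^ ?p) ^ (e div ?p) = h x ^ e" for x
      by (simp flip: power_mult power_add)
    then show ?thesis
      using differences_vanish_mult[OF low high] digit_sum_rec[OF p, of e] by simp
  qed
qed

text \<open>Exponents are plain functions here, so that a single one can be changed by function
  update.\<close>

definition monomial_fun :: "('n::finite \<Rightarrow> nat) \<Rightarrow> 'a::comm_ring_1 ^ 'n \<Rightarrow> 'a" where
  "monomial_fun u x = (\<Prod>i\<in>UNIV. (x $ i) ^ u i)"

lemma differences_vanish_monomial_fun:
  fixes u :: "'n::finite \<Rightarrow> nat"
  assumes "prime CHAR('a::comm_ring_1)"
  shows "differences_vanish (Suc (\<Sum>i\<in>UNIV. digit_sum CHAR('a) (u i)))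
    (monomial_fun u :: 'a ^ 'n \<Rightarrow> 'a)"
  unfolding monomial_fun_def[abs_def] using assms
  by (intro differences_vanish_prod differences_vanish_additive_power)
     (simp_all add: additive_def)

section \<open>Isolating monomials and bounding their weight\<close>

text \<open>The weights are the coefficients at \<open>X ^ k\<close> of the Lagrange basis polynomials of \<open>A\<close>.\<close>

lemma power_separating_weights:
  fixes A :: "'a::field set"
  assumes "finite A"
  obtains w where "\<And>e. e < card A \<Longrightarrow> (\<Sum>y\<in>A. w y * y ^ e) = (if e = k then 1 else 0)"
proof
  define M where "M y = (\<Prod>z\<in>A - {y}. [:- z, 1:])" for y
  define L where "L y = Polynomial.smult (inverse (poly (M y) y)) (M y)" for y
  fix e assume e: "e < card A"
  have M_nz: "poly (M y) y \<noteq> 0" for y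
    using assms by (auto simp: M_def poly_prod)
  have L: "poly (L y) z = (if y = z then 1 else 0)" if "z \<in> A" for y z
  proof (cases "y = z")
    case True
    then show ?thesis using M_nz by (simp add: L_def)
  next
    case False
    then have "poly (M y) z = 0"
      using that assms by (auto simp: M_def poly_prod)
    then show ?thesis using False by (simp add: L_def)
  qed
  have deg: "degree (L y) < card A" if "y \<in> A" for y
  proof -
    have "degree (L y) \<le> degree (M y)" by (simp add: L_def degree_smult_le)
    also have "\<dots> \<le> (\<Sum>z\<in>A - {y}. degree [:- z, 1:])"
      unfolding M_def using degree_prod_sum_le[of "A - {y}" "\<lambda>z. [:- z, 1:]"] assms by (simp add: o_def)
    also have "\<dots> = card A - 1" using that assms by simp
    also have "\<dots> < card A" using e by simp
    finally show ?thesis .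
  qed
  \<comment> \<open>Lagrange interpolation: both sides agree on \<open>A\<close> and have degree
    below \<open>card A\<close>, which is where \<open>e < card A\<close> enters. Comparing
    coefficients at \<open>k\<close> gives the claim.\<close>
  have "(\<Sum>y\<in>A. Polynomial.smult (y ^ e) (L y)) = Polynomial.monom 1 e"
  proof (rule poly_eqI_degree[of A])
    fix z assume z: "z \<in> A"
    have "poly (\<Sum>y\<in>A. Polynomial.smult (y ^ e) (L y)) z = (\<Sum>y\<in>A. if y = z then z ^ e else 0)"
      unfolding poly_sum by (rule sum.cong) (use L z in auto)
    also have "\<dots> = z ^ e" using z assms by simp
    finally show "poly (\<Sum>y\<in>A. Polynomial.smult (y ^ e) (L y)) z = poly (Polynomial.monom 1 e) z"
      by (simp add: poly_monom)
  next
    show "degree (\<Sum>y\<in>A. Polynomial.smult (y ^ e) (L y)) < card A"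
      using e deg by (intro degree_sum_less) (auto intro: le_less_trans[OF degree_smult_le])
  next
    show "degree (Polynomial.monom (1::'a) e) < card A"
      using e by (simp add: degree_monom_eq)
  qed
  then have "coeff (\<Sum>y\<in>A. Polynomial.smult (y ^ e) (L y)) k = coeff (Polynomial.monom 1 e) k"
    by simp
  then show "(\<Sum>y\<in>A. coeff (L y) k * y ^ e) = (if e = k then 1 else 0)"
    by (simp add: coeff_sum mult.commute)
qed

text \<open>Scaling the coordinates by \<open>y\<close> multiplies the monomial of \<open>u\<close>
  by the product of the \<open>y i ^ u i\<close>. Separating weights chosen for each exponent
  \<open>v i\<close> combine these scalings so that only the monomial of \<open>v\<close>
  survives.\<close>

lemma differences_vanish_monomial_component:
  fixes c :: "('n::finite \<Rightarrow> nat) \<Rightarrow> 'a::{field,finite}"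
  assumes "finite U" and lt: "\<And>u i. u \<in> U \<Longrightarrow> u i < CARD('a)"
    and van: "differences_vanish n (\<lambda>x::'a ^ 'n. \<Sum>u\<in>U. c u * monomial_fun u x)"
    and v: "v \<in> U" "c v \<noteq> 0"
  shows "differences_vanish n (monomial_fun v :: 'a ^ 'n \<Rightarrow> 'a)"
proof -
  have "\<exists>w. \<forall>e<CARD('a). (\<Sum>y\<in>UNIV. w y * y ^ e) = (if e = v i then 1 else (0::'a))" for i
    using power_separating_weights[OF finite[of "UNIV :: 'a set"], of "v i"] by metis
  then obtain w where w: "\<And>i e. e < CARD('a) \<Longrightarrow>
      (\<Sum>y\<in>UNIV. w i y * y ^ e) = (if e = v i then 1 else (0::'a))"
    by metis
  define T where "T y x = (\<chi> i. y i * x $ i)" for y :: "'n \<Rightarrow> 'a" and x :: "'a ^ 'n"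
  have T: "additive (T y)" for y
    by (simp add: T_def additive_def vec_eq_iff distrib_left)
  have mon_T: "monomial_fun u (T y x) = (\<Prod>i\<in>UNIV. y i ^ u i) * monomial_fun u x" for u y x
    by (simp add: T_def monomial_fun_def power_mult_distrib prod.distrib)
  have sep: "(\<Sum>y\<in>UNIV. (\<Prod>i\<in>UNIV. w i (y i)) * monomial_fun u (T y x)) =
      (if u = v then monomial_fun v x else 0)" if "u \<in> U" for u x
  proof -
    \<comment> \<open>Summing over all scaling vectors factors into one-variable sums, each of which
      tests whether \<open>u i = v i\<close>.\<close>
    have "(\<Sum>y\<in>UNIV. \<Prod>i\<in>UNIV. w i (y i) * y i ^ u i) =
        (\<Prod>i\<in>UNIV. \<Sum>z\<in>UNIV. w i z * z ^ u i)"
      using prod_sum_PiE[of UNIV "\<lambda>_. UNIV" "\<lambda>i z. w i z * z ^ u i"] by simp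
    also have "\<dots> = (\<Prod>i\<in>UNIV. if u i = v i then 1 else 0)"
      by (rule prod.cong) (simp_all add: w lt[OF that])
    also have "\<dots> = (if u = v then 1 else 0)"
    proof (cases "u = v")
      case False
      then obtain l where "u l \<noteq> v l" by auto
      then have "(\<Prod>i\<in>UNIV. if u i = v i then 1 else 0) = (0 :: 'a)"
        by (intro prod_zero) auto
      then show ?thesis using False by simp
    qed simp
    finally have coeff: "(\<Sum>y\<in>UNIV. \<Prod>i\<in>UNIV. w i (y i) * y i ^ u i) =
        (if u = v then 1 else 0)" .
    have "(\<Sum>y\<in>UNIV. (\<Prod>i\<in>UNIV. w i (y i)) * monomial_fun u (T y x)) =
        (\<Sum>y\<in>UNIV. \<Prod>i\<in>UNIV. w i (y i) * y i ^ u i) * monomial_fun u x"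
      unfolding sum_distrib_right mon_T prod.distrib mult.assoc ..
    also have "\<dots> = (if u = v then monomial_fun v x else 0)"
      unfolding coeff by (cases "u = v") simp_all
    finally show ?thesis .
  qed
  have "(\<Sum>y\<in>UNIV. (\<Prod>i\<in>UNIV. w i (y i)) * (\<Sum>u\<in>U. c u * monomial_fun u (T y x))) =
      c v * monomial_fun v x" for x
  proof -
    have "(\<Sum>y\<in>UNIV. (\<Prod>i\<in>UNIV. w i (y i)) * (\<Sum>u\<in>U. c u * monomial_fun u (T y x))) =
        (\<Sum>u\<in>U. c u * (\<Sum>y\<in>UNIV. (\<Prod>i\<in>UNIV. w i (y i)) * monomial_fun u (T y x)))"
      unfolding sum_distrib_left by (subst sum.swap) (simp only: mult.left_commute)
    also have "\<dots> = (\<Sum>u\<in>U. if u = v then c v * monomial_fun v x else 0)"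
      by (rule sum.cong) (auto simp: sep)
    also have "\<dots> = c v * monomial_fun v x"
      using assms(1) v(1) by simp
    finally show ?thesis .
  qed
  moreover have "differences_vanish n
      (\<lambda>x. \<Sum>y\<in>UNIV. (\<Prod>i\<in>UNIV. w i (y i)) * (\<Sum>u\<in>U. c u * monomial_fun u (T y x)))"
    by (intro differences_vanish_sum differences_vanish_scale
         differences_vanish_precompose_additive[OF T van])
  ultimately have "differences_vanish n (\<lambda>x. c v * monomial_fun v x)"
    by simp
  from differences_vanish_scale[OF this, of "inverse (c v)"] show ?thesis
    using v(2) by (simp flip: mult.assoc)
qed

text \<open>By Frobenius, \<open>x $ i + 1\<close> raised to the power \<open>CHAR('a) ^ j\<close>
  is \<open>(x $ i) ^ CHAR('a) ^ j + 1\<close>. The binomial theorem with exponent \<open>m\<close>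
  then applies, and the difference removes the top term \<open>k = m\<close>.\<close>

lemma difference_monomial_fun_axis:
  fixes u :: "'n::finite \<Rightarrow> nat"
  assumes "prime CHAR('a::comm_ring_1)" and u: "u i = CHAR('a) ^ j * m"
  shows "difference (axis i 1) (monomial_fun u :: 'a ^ 'n \<Rightarrow> 'a) =
    (\<lambda>x. \<Sum>k<m. of_nat (m choose k) * monomial_fun (u(i := CHAR('a) ^ j * k)) x)"
proof
  fix x :: "'a ^ 'n"
  define P where "P = (\<Prod>l\<in>UNIV - {i}. (x $ l) ^ u l)"
  define Q where "Q = CHAR('a) ^ j"
  have upd: "monomial_fun (u(i := Q * k)) x = ((x $ i) ^ Q) ^ k * P" for k
    unfolding monomial_fun_def P_def
    by (subst prod.remove[of _ i]) (auto simp: power_mult intro!: prod.cong)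
  have mx: "monomial_fun u x = ((x $ i) ^ Q) ^ m * P"
    using upd[of m] u by (simp add: Q_def fun_upd_idem)
  have shift: "monomial_fun u (x + axis i 1) = ((x $ i + 1) ^ Q) ^ m * P"
    unfolding monomial_fun_def P_def
    by (subst prod.remove[of _ i])
       (auto simp: u Q_def axis_def power_mult intro!: prod.cong)
  have frob: "(x $ i + 1) ^ Q = (x $ i) ^ Q + 1"
    using freshmans_dream'[OF assms(1) Q_def, of "x $ i" 1] by simp
  have "((x $ i) ^ Q + 1) ^ m = (\<Sum>k\<le>m. of_nat (m choose k) * ((x $ i) ^ Q) ^ k)"
    by (simp add: binomial_ring)
  also have "\<dots> = (\<Sum>k<m. of_nat (m choose k) * ((x $ i) ^ Q) ^ k) + ((x $ i) ^ Q) ^ m"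
    unfolding lessThan_Suc_atMost[symmetric] by simp
  finally have binom: "((x $ i) ^ Q + 1) ^ m =
      (\<Sum>k<m. of_nat (m choose k) * ((x $ i) ^ Q) ^ k) + ((x $ i) ^ Q) ^ m" .
  have "difference (axis i 1) (monomial_fun u) x =
      (\<Sum>k<m. of_nat (m choose k) * ((x $ i) ^ Q) ^ k) * P"
    unfolding difference_def shift frob binom mx by (simp add: distrib_right)
  also have "\<dots> = (\<Sum>k<m. of_nat (m choose k) * monomial_fun (u(i := Q * k)) x)"
    unfolding upd sum_distrib_right mult.assoc ..
  finally show "difference (axis i 1) (monomial_fun u) x =
      (\<Sum>k<m. of_nat (m choose k) * monomial_fun (u(i := CHAR('a) ^ j * k)) x)"
    unfolding Q_def .
qed

text \<open>Induction on \<open>n\<close>: one difference in a suitable coordinate produces a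
  monomial of weight one less, which can be isolated. Index 0 is impossible because a monomial takes
  the value 1 at the all-ones vector.\<close>

lemma digit_sum_less_if_differences_vanish:
  fixes u :: "'n::finite \<Rightarrow> nat"
  assumes "differences_vanish n (monomial_fun u :: 'a::finite_field ^ 'n \<Rightarrow> 'a)"
    and "\<And>i. u i < CARD('a)"
  shows "(\<Sum>i\<in>UNIV. digit_sum CHAR('a) (u i)) < n"
  using assms
proof (induction n arbitrary: u)
  case 0
  have "monomial_fun u (1 :: 'a ^ 'n) = 1"
    by (simp add: monomial_fun_def)
  then show ?case using 0 by simp
next
  case (Suc n)
  let ?p = "CHAR('a)"
  have p: "prime ?p" "?p \<ge> 2" using prime_ge_2_nat[of ?p] by auto
  show ?case
  proof (cases "\<exists>i. u i \<noteq> 0")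
    case False
    then show ?thesis by simp
  next
    case True
    then obtain i where i: "u i \<noteq> 0" by blast
    obtain m where m: "u i = ?p ^ multiplicity ?p (u i) * m" "\<not> ?p dvd m"
      using multiplicity_decompose'[of "u i" ?p] i p by auto
    define Q where "Q = ?p ^ multiplicity ?p (u i)"
    have um: "u i = Q * m" unfolding Q_def by (rule m(1))
    have Q: "Q > 0" using p by (simp add: Q_def)
    have m0: "m > 0" using m(2) by (auto intro: Nat.gr0I)
    define v where "v k = u(i := Q * k)" for k
    have inj: "inj_on v {..<m}"
      using Q by (auto simp: v_def inj_on_def dest!: fun_cong[of _ _ i])
    \<comment> \<open>Coefficients must depend on the exponent vector to fit the isolation lemma;
      dividing its entry at \<open>i\<close> by \<open>Q\<close> recovers \<open>k\<close>.\<close>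
    define c where "c u' = (of_nat (m choose (u' i div Q)) :: 'a)" for u' :: "'n \<Rightarrow> nat"
    have cv: "c (v k) = of_nat (m choose k)" for k
      using Q by (simp add: c_def v_def)
    have "difference (axis i 1) (monomial_fun u :: 'a ^ 'n \<Rightarrow> 'a) =
        (\<lambda>x. \<Sum>u'\<in>v ` {..<m}. c u' * monomial_fun u' x)"
      using difference_monomial_fun_axis[OF p(1), of u i, OF m(1)]
      by (simp add: sum.reindex[OF inj] cv flip: Q_def v_def)
    then have "differences_vanish n (\<lambda>x::'a ^ 'n. \<Sum>u'\<in>v ` {..<m}. c u' * monomial_fun u' x)"
      using Suc.prems(1) by (metis differences_vanish.simps(2))
    moreover have lt: "v k l < CARD('a)" if "k < m" for k l
    proof -
      have "Q * k < u i" unfolding um using Q that by simp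
      then show ?thesis using Suc.prems(2)[of i] Suc.prems(2)[of l] by (auto simp: v_def)
    qed
    \<comment> \<open>The coefficient is \<open>m choose (m - 1) = m\<close>, nonzero in the field
      because the characteristic does not divide \<open>m\<close>.\<close>
    moreover have "c (v (m - 1)) \<noteq> 0"
      using m(2) m0 binomial_symmetric[of 1 m]
      by (simp add: cv of_nat_eq_0_iff_char_dvd)
    ultimately have "differences_vanish n (monomial_fun (v (m - 1)) :: 'a ^ 'n \<Rightarrow> 'a)"
      using m0 by (intro differences_vanish_monomial_component[where U = "v ` {..<m}" and c = c]) auto
    then have IH: "(\<Sum>l\<in>UNIV. digit_sum ?p (v (m - 1) l)) < n"
      using lt m0 by (intro Suc.IH) auto
    \<comment> \<open>The factor \<open>Q\<close> only appends zero digits, so passing from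
      \<open>Q * m\<close> to \<open>Q * (m - 1)\<close> lowers the digit sum by one.\<close>
    have "digit_sum ?p (u i) = Suc (digit_sum ?p (v (m - 1) i))"
      using digit_sum_pred[OF p(2) m(2)] digit_sum_power_mult[OF p(2)]
      unfolding um by (simp add: v_def Q_def)
    moreover have "(\<Sum>l\<in>UNIV - {i}. digit_sum ?p (u l)) =
        (\<Sum>l\<in>UNIV - {i}. digit_sum ?p (v (m - 1) l))"
      by (rule sum.cong) (auto simp: v_def)
    ultimately show ?thesis
      using IH by (simp add: sum.remove[of UNIV i])
  qed
qed

section \<open>Functional degree and weight degree of a polynomial\<close>

theorem theorem12p3:
  fixes p \<alpha> q :: nat
    and E :: "('n::finite \<Rightarrow>\<^sub>0 nat) set"
    and c :: "('n \<Rightarrow>\<^sub>0 nat) \<Rightarrow> 'a::finite_field"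
    and f :: "('n \<Rightarrow>\<^sub>0 nat) \<Rightarrow>\<^sub>0 'a"
  assumes "prime p" and "\<alpha> \<ge> 1"
    and "q = p ^ \<alpha>" and "CARD('a) = q"
    and "finite E" and "\<And>e. e \<in> E \<Longrightarrow> c e \<noteq> 0"
    and "f = (\<Sum>e\<in>E. Poly_Mapping.single e (c e))"
  shows "Fdeg (poly_fun f) \<le> enat (weight_degree p f) \<and>
         ((\<forall>e\<in>E. \<forall>i. Poly_Mapping.lookup e i \<le> q - 1) \<longrightarrow>
           Fdeg (poly_fun f) = enat (weight_degree p f))"
proof -
  have "CHAR('a) dvd p ^ \<alpha>"
    using CHAR_dvd_CARD[where 'a = 'a] assms(3,4) by simp
  then have p: "CHAR('a) = p"
    using assms(1) by (metis CHAR_prime prime_dvd_power primes_dvd_imp_eq)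
  have lookup_f: "Poly_Mapping.lookup f e = (if e \<in> E then c e else 0)" for e
    using assms(5) by (simp add: assms(7) lookup_sum lookup_single when_def)
  have keys_f: "Poly_Mapping.keys f = E"
    using assms(6) by (auto simp: in_keys_iff lookup_f split: if_splits)
  have poly_f: "poly_fun f = (\<lambda>x. \<Sum>e\<in>E. c e * monomial_fun (Poly_Mapping.lookup e) x)"
    by (simp add: poly_fun_def keys_f monomial_fun_def lookup_f fun_eq_iff)
  have wd: "weight_degree p f = (if E = {} then 0 else Max (weight p ` E))"
    using keys_f by (auto simp: weight_degree_def)
  have "differences_vanish (Suc (weight_degree p f)) (poly_fun f)"
    unfolding poly_f
  proof (intro differences_vanish_sum differences_vanish_scale)
    fix e assume e: "e \<in> E"
    have "differences_vanish (Suc (weight p e)) (monomial_fun (Poly_Mapping.lookup e) :: 'a ^ 'n \<Rightarrow> 'a)"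
      using differences_vanish_monomial_fun[where 'a = 'a, of "Poly_Mapping.lookup e"] assms(1)
      by (simp only: p weight_def)
    moreover have "weight p e \<le> weight_degree p f"
      using e assms(5) by (auto simp: wd)
    ultimately show "differences_vanish (Suc (weight_degree p f))
        (monomial_fun (Poly_Mapping.lookup e) :: 'a ^ 'n \<Rightarrow> 'a)"
      by (metis Suc_le_mono differences_vanish_mono)
  qed
  then have le: "Fdeg (poly_fun f) \<le> enat (weight_degree p f)"
    by (simp only: Fdeg_le_iff)
  moreover have "enat (weight_degree p f) \<le> Fdeg (poly_fun f)"
    if bound: "\<forall>e\<in>E. \<forall>i. Poly_Mapping.lookup e i \<le> q - 1"
  proof (cases "E = {}")
    \<comment> \<open>For the zero polynomial the weight degree is 0 by convention, so the lower
      bound is trivial.\<close>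
    case True
    then show ?thesis by (simp add: wd flip: zero_enat_def)
  next
    case False
    then have "weight_degree p f \<in> weight p ` E"
      using assms(5) by (simp add: wd)
    then obtain v where v: "v \<in> E" "weight_degree p f = weight p v" by blast
    have q: "0 < CARD('a)" by simp
    have lt: "Poly_Mapping.lookup e i < CARD('a)" if "e \<in> E" for e i
      using bound that q assms(4) by (metis One_nat_def Suc_pred le_imp_less_Suc)
    have inj: "inj_on Poly_Mapping.lookup E"
      by (auto simp: inj_on_def)
    \<comment> \<open>The upper bound already shows that the functional degree is finite.\<close>
    obtain d where d: "Fdeg (poly_fun f) = enat d"
      using le by (cases "Fdeg (poly_fun f)") auto
    \<comment> \<open>The sum is reindexed by exponent functions to match the isolation lemma;
      \<open>Abs_poly_mapping\<close> recovers the exponent vector for the coefficient.\<close>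
    have eq: "poly_fun f = (\<lambda>x. \<Sum>u\<in>Poly_Mapping.lookup ` E.
        Poly_Mapping.lookup f (Abs_poly_mapping u) * monomial_fun u x)"
      using inj by (simp add: poly_f sum.reindex lookup_f)
    have "differences_vanish (Suc d) (poly_fun f)"
      using d by (simp only: Fdeg_le_iff[symmetric])
    then have "differences_vanish (Suc d) (monomial_fun (Poly_Mapping.lookup v) :: 'a ^ 'n \<Rightarrow> 'a)"
      unfolding eq
      by (rule differences_vanish_monomial_component[rotated 2])
         (use assms(5,6) lt v in \<open>auto simp: lookup_f\<close>)
    then have "weight p v < Suc d"
      using digit_sum_less_if_differences_vanish[where 'a = 'a] lt[OF v(1)]
      unfolding p weight_def by blast
    then show ?thesis using d v(2) by simp
  qed
  ultimately show ?thesis by (intro conjI impI antisym)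
qed

end
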